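(* Let $(s_m)_{m=1}^\infty$ be a non-decreasing unbounded sequence of positive scalars. Suppose that $(m/s_m)_{m=1}^\infty$ is unbounded and non-decreasing. Then there is a Banach space $\mathbb{X}$ and a conditional bidemocratic quasi-greedy basis $\mathcal{X}$ of $\mathbb{X}$ whose fundamental function grows as $(s_m)_{m=1}^\infty$, i.e., whose fundamental function $\varphi$ satisfies $c\,s_m\le\varphi(m)\le C\,s_m$ for all $m\in\mathbb{N}$ and some constants $0<c\le C<\infty$.
   Context: The scalar field $\mathbb{F}$ is $\mathbb{R}$ or $\mathbb{C}$. A basis of a Banach space $\mathbb{X}$ is a norm-bounded sequence $\mathcal{X}=(x_n)_{n=1}^\infty$ with $\overline{\operatorname{span}}(x_n\colon n\in\mathbb{N})=\mathbb{X}$ for which there is a (unique) norm-bounded sequence $(x_n^* )_{n=1}^\infty$ in $\mathbb{X}^*$ with $x_n^*(x_k)=\delta_{n,k}$. The fundamental function is $\varphi(m)=\sup_{|A|\le m}\|\sum_{k\in A}x_k\|$; put $\varphi^*(m)=\sup_{|A|\le m}\|\sum_{k\in A}x_k^*\|$. The basis is bidemocratic if there is a constant $\Delta_b$ with $\varphi(m)\varphi^*(m)\le\Delta_b\,m$ for all $m\in\mathbb{N}$. For finite $A\subseteq\mathbb{N}$ let $S_A(f)=\sum_{n\in A}x_n^*(f)x_n$. The basis is unconditional if $\sup_{A\text{ finite}}\|S_A\|<\infty$, and conditional if it is not unconditional. A finite set $A\subseteq\mathbb{N}$ is a greedy set of $f\in\mathbb{X}$ if $|x_n^*(f)|\ge|x_k^*(f)|$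 whenever $n\in A$, $k\notin A$. The basis is quasi-greedy if there is a constant $C$ such that $\|S_A(f)\|\le C\|f\|$ for all $f\in\mathbb{X}$ and all greedy sets $A$ of $f$. *)

theory Defs
  imports "HOL-Analysis.Analysis" "HOL-Library.Function_Algebras"
begin

text \<open>
  HOL-Analysis provides only normed spaces over the reals, and HOL cannot quantify
  existentially over types. A normed space over \<open>'k\<close> (below: the reals or the complex
  numbers) is therefore a linear subspace \<open>X\<close> of some vector space over \<open>'k\<close>, together with a
  norm \<open>N\<close> whose values matter only on \<open>X\<close>. Nothing is assumed about the ambient vector space.
\<close>

locale normed_carrier = vector_space scale
  for scale :: "'k::real_normed_field \<Rightarrow> 'v::ab_group_add \<Rightarrow> 'v" (infixr \<open>*s\<close> 75) +
  fixes X :: "'v set" and N :: "'v \<Rightarrow> real"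
  assumes subspace_X: "subspace X"
    and N_nonneg: "v \<in> X \<Longrightarrow> 0 \<le> N v"
    and N_eq_0: "v \<in> X \<Longrightarrow> N v = 0 \<longleftrightarrow> v = 0"
    and N_scale: "v \<in> X \<Longrightarrow> N (c *s v) = norm c * N v"
    and N_triangle: "v \<in> X \<Longrightarrow> w \<in> X \<Longrightarrow> N (v + w) \<le> N v + N w"
begin

text \<open>The locale \<^locale>\<open>Metric_space\<close> wants symmetry and nonnegativity off the carrier as well.\<close>

definition ndist :: "'v \<Rightarrow> 'v \<Rightarrow> real" where
  "ndist v w = (if v \<in> X \<and> w \<in> X then N (v - w) else 0)"

lemma N_minus_commute:
  assumes "v \<in> X" "w \<in> X"
  shows "N (v - w) = N (w - v)"
proof -
  have "w - v \<in> X"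
    using assms subspace_X by (simp add: subspace_diff)
  then have "N ((- 1) *s (w - v)) = N (w - v)"
    by (simp only: N_scale) simp
  then show ?thesis by simp
qed

sublocale metric: Metric_space X ndist
proof
  fix u v w
  show "0 \<le> ndist v w"
    using N_nonneg subspace_X by (simp add: ndist_def subspace_diff)
  show "ndist v w = ndist w v"
    by (simp add: ndist_def N_minus_commute)
  show "ndist v w = 0 \<longleftrightarrow> v = w" if "v \<in> X" "w \<in> X"
    using that N_eq_0 subspace_X by (simp add: ndist_def subspace_diff)
  show "ndist u w \<le> ndist u v + ndist v w" if "u \<in> X" "v \<in> X" "w \<in> X"
    using that N_triangle[of "u - v" "v - w"] subspace_X
    by (simp add: ndist_def subspace_diff)
qed

text \<open>
  The supremum is a genuine one (rather than an unspecified value) precisely for bounded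
  operators; it is only applied to those.
\<close>

definition op_norm :: "('w \<Rightarrow> real) \<Rightarrow> ('v \<Rightarrow> 'w) \<Rightarrow> real" where
  "op_norm M T = (SUP v\<in>{v \<in> X. N v \<le> 1}. M (T v))"

text \<open>
  The dual space. A functional on \<open>X\<close> is represented by its extension by \<open>0\<close> to the ambient
  space, so that functionals which agree on \<open>X\<close> are equal.
\<close>

definition dual :: "('v \<Rightarrow> 'k) set" where
  "dual = {f. (\<forall>v\<in>X. \<forall>w\<in>X. f (v + w) = f v + f w) \<and> (\<forall>c. \<forall>v\<in>X. f (c *s v) = c * f v) \<and>
              (\<exists>C. \<forall>v\<in>X. norm (f v) \<le> C * N v) \<and> (\<forall>v. v \<notin> X \<longrightarrow> f v = 0)}"

abbreviation dual_norm :: "('v \<Rightarrow> 'k) \<Rightarrow> real" where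
  "dual_norm \<equiv> op_norm norm"

text \<open>Sequences are indexed from \<open>0\<close>, i.e. \<open>x n\<close> is the usual \<open>x\<^bsub>n+1\<^esub>\<close>.\<close>

definition biorthogonal_seq :: "(nat \<Rightarrow> 'v) \<Rightarrow> (nat \<Rightarrow> 'v \<Rightarrow> 'k) \<Rightarrow> bool" where
  "biorthogonal_seq x xs \<longleftrightarrow>
     (\<forall>n. xs n \<in> dual) \<and> (\<exists>C. \<forall>n. dual_norm (xs n) \<le> C) \<and>
     (\<forall>n k. xs n (x k) = (if n = k then 1 else 0))"

definition is_basis :: "(nat \<Rightarrow> 'v) \<Rightarrow> bool" where
  "is_basis x \<longleftrightarrow>
     range x \<subseteq> X \<and> (\<exists>C. \<forall>n. N (x n) \<le> C) \<and>
     metric.mtopology closure_of span (range x) = X \<and>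
     (\<exists>xs. biorthogonal_seq x xs)"

definition coord :: "(nat \<Rightarrow> 'v) \<Rightarrow> nat \<Rightarrow> 'v \<Rightarrow> 'k" where
  "coord x = (THE xs. biorthogonal_seq x xs)"

definition fundamental :: "(nat \<Rightarrow> 'v) \<Rightarrow> nat \<Rightarrow> real" where
  "fundamental x m = (SUP A\<in>{A. finite A \<and> card A \<le> m}. N (\<Sum>k\<in>A. x k))"

definition dual_fundamental :: "(nat \<Rightarrow> 'v) \<Rightarrow> nat \<Rightarrow> real" where
  "dual_fundamental x m =
     (SUP A\<in>{A. finite A \<and> card A \<le> m}. dual_norm (\<lambda>v. \<Sum>k\<in>A. coord x k v))"

definition bidemocratic :: "(nat \<Rightarrow> 'v) \<Rightarrow> bool" where
  "bidemocratic x \<longleftrightarrow>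
     (\<exists>\<Delta>. \<forall>m\<ge>1. fundamental x m * dual_fundamental x m \<le> \<Delta> * real m)"

definition coord_proj :: "(nat \<Rightarrow> 'v) \<Rightarrow> nat set \<Rightarrow> 'v \<Rightarrow> 'v" where
  "coord_proj x A v = (\<Sum>n\<in>A. coord x n v *s x n)"

definition unconditional :: "(nat \<Rightarrow> 'v) \<Rightarrow> bool" where
  "unconditional x \<longleftrightarrow> bdd_above ((\<lambda>A. op_norm N (coord_proj x A)) ` {A. finite A})"

abbreviation conditional :: "(nat \<Rightarrow> 'v) \<Rightarrow> bool" where
  "conditional x \<equiv> \<not> unconditional x"

definition greedy_set :: "(nat \<Rightarrow> 'v) \<Rightarrow> 'v \<Rightarrow> nat set \<Rightarrow> bool" where
  "greedy_set x v A \<longleftrightarrow>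
     finite A \<and> (\<forall>n\<in>A. \<forall>k. k \<notin> A \<longrightarrow> norm (coord x k v) \<le> norm (coord x n v))"

definition quasi_greedy :: "(nat \<Rightarrow> 'v) \<Rightarrow> bool" where
  "quasi_greedy x \<longleftrightarrow>
     (\<exists>C. \<forall>v\<in>X. \<forall>A. greedy_set x v A \<longrightarrow> N (coord_proj x A v) \<le> C * N v)"

text \<open>The description in \<^const>\<open>coord\<close> is proper: functionals in the dual are determined by
  their values on a sequence with dense linear span.\<close>

lemma dual_eqI:
  assumes f: "f \<in> dual" and g: "g \<in> dual" and x: "range x \<subseteq> X"
    and dense: "metric.mtopology closure_of span (range x) = X"
    and eq: "\<And>k. f (x k) = g (x k)"
  shows "f = g"
proof
  fix v
  have add: "f (u + w) - g (u + w) = (f u - g u) + (f w - g w)" if "u \<in> X" "w \<in> X" for u w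
    using f g that by (simp add: dual_def)
  have scl: "f (c *s u) - g (c *s u) = c * (f u - g u)" if "u \<in> X" for c u
    using f g that by (simp add: dual_def algebra_simps)
  have "\<exists>C. \<forall>u\<in>X. norm (f u) \<le> C * N u"
    using f by (simp add: dual_def)
  then obtain C where C: "\<And>u. u \<in> X \<Longrightarrow> norm (f u) \<le> C * N u"
    by blast
  have "\<exists>C. \<forall>u\<in>X. norm (g u) \<le> C * N u"
    using g by (simp add: dual_def)
  then obtain D where D: "\<And>u. u \<in> X \<Longrightarrow> norm (g u) \<le> D * N u"
    by blast
  have bnd: "norm (f u - g u) \<le> (\<bar>C\<bar> + \<bar>D\<bar>) * N u" if "u \<in> X" for u
  proof -
    have "norm (f u - g u) \<le> C * N u + D * N u"
      using norm_triangle_ineq4[of "f u" "g u"] C[OF that] D[OF that] by linarith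
    also have "\<dots> \<le> \<bar>C\<bar> * N u + \<bar>D\<bar> * N u"
      by (intro add_mono mult_right_mono N_nonneg that) auto
    finally show ?thesis by (simp add: algebra_simps)
  qed
  have span0: "u \<in> X \<and> f u - g u = 0" if "u \<in> span (range x)" for u
    using that
  proof (induction rule: span_induct_alt)
    case base
    have "0 \<in> X" using subspace_X by (simp add: subspace_0)
    then show ?case using scl[of 0 0] by simp
  next
    case (step c z y)
    then obtain k where k: "z = x k" by auto
    have z: "z \<in> X" using k x by auto
    have cz: "c *s z \<in> X" using z subspace_X by (simp add: subspace_scale)
    have "c *s z + y \<in> X" using cz step subspace_X by (simp add: subspace_add)
    moreover have "f (c *s z + y) - g (c *s z + y) = 0"
      using add[of "c *s z" y] scl[of z c] cz z step eq[of k] k by simp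
    ultimately show ?case by blast
  qed
  show "f v = g v"
  proof (cases "v \<in> X")
    case False
    then show ?thesis using f g by (simp add: dual_def)
  next
    case True
    have "norm (f v - g v) \<le> 0 + e" if "e > 0" for e
    proof -
      let ?K = "\<bar>C\<bar> + \<bar>D\<bar> + 1"
      have "e / ?K > 0" using that by simp
      moreover have "v \<in> metric.mtopology closure_of span (range x)"
        using True dense by simp
      ultimately obtain y where y: "y \<in> span (range x)" "y \<in> metric.mball v (e / ?K)"
        unfolding metric.metric_closure_of by blast
      have yX: "y \<in> X" and y0: "f y - g y = 0" using span0[OF y(1)] by auto
      have vy: "v - y \<in> X" using True yX subspace_X by (simp add: subspace_diff)
      have small: "N (v - y) < e / ?K"
        using y(2) True yX by (simp add: ndist_def)
      have "f v - g v = f (v - y) - g (v - y)"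
        using add[OF vy yX] y0 by simp
      then have "norm (f v - g v) \<le> (\<bar>C\<bar> + \<bar>D\<bar>) * N (v - y)"
        using bnd[OF vy] by simp
      also have "\<dots> \<le> ?K * N (v - y)"
        by (intro mult_right_mono N_nonneg vy) auto
      also have "\<dots> \<le> ?K * (e / ?K)"
        using small by (intro mult_left_mono) auto
      finally show ?thesis by simp
    qed
    then have "norm (f v - g v) \<le> 0" by (rule field_le_epsilon)
    then show ?thesis by simp
  qed
qed

lemma coord_eq:
  assumes "is_basis x" and "biorthogonal_seq x xs"
  shows "coord x = xs"
  unfolding coord_def
proof (rule the_equality)
  show "biorthogonal_seq x xs" by fact
  fix ys assume ys: "biorthogonal_seq x ys"
  show "ys = xs"
  proof
    fix n
    show "ys n = xs n"
      using assms ys unfolding is_basis_def biorthogonal_seq_def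
      by (intro dual_eqI[of _ _ x]) auto
  qed
qed

end

locale banach_carrier = normed_carrier +
  assumes complete: metric.mcomplete

text \<open>
  The ambient space used for existence statements: scalar sequences with pointwise operations.
  This is no restriction. A space with a basis is separable and infinite-dimensional, so if it
  is complete its algebraic dimension is that of the continuum, which is also the dimension of
  the space of all scalar sequences; hence it is linearly isomorphic to that space, and its norm
  can be transported.
\<close>

definition seq_scale :: "'k::real_normed_field \<Rightarrow> (nat \<Rightarrow> 'k) \<Rightarrow> (nat \<Rightarrow> 'k)" where
  "seq_scale c v = (\<lambda>i. c * v i)"

lemma vector_space_seq_scale: "vector_space seq_scale"
  by unfold_locales (auto simp: seq_scale_def algebra_simps fun_eq_iff)

end

(* The space is a Konyagin-Temlyakov type space: the closure of the finitely supported sequences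
   in the norm  N(v) = sup s(|A|)/|A| * sum_(n in A) |v_n|  +  sup_m |sum_(n < m) w_n v_n|,  with
   nonincreasing weights w_n whose partial sums are at most 3 s(m).
   The first (Marcinkiewicz) part gives |sum_(n in A) v_n| <= |A|/s(|A|) N(v), hence the dual
   fundamental function is at most m/s(m); together with a fundamental function between s and 4s
   this is bidemocracy.  Quasi-greediness follows by cutting the weighted sum over a greedy set A
   at |A|.  For conditionality one needs a nonincreasing sequence a_n with partial sums O(m/s(m))
   and sum a_n w_n infinite: with alternating signs it is bounded in N, its even part is not.
   Both w and a are step functions on blocks bounded by q(0) < q(1) < ..., where s and m/s(m)
   at least double from q(k) to q(k+1): on the block ending at r, w = s(r)/r and a = 1/s(r). *)

theory Submission
  imports Defs
begin

section \<open>Norms given as suprema of seminorms\<close>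

definition unit_seq :: "nat \<Rightarrow> nat \<Rightarrow> 'k::real_normed_field" where
  "unit_seq n = (\<lambda>i. if i = n then 1 else 0)"

lemma sum_seq_apply: "sum (f :: 'i \<Rightarrow> nat \<Rightarrow> 'k::real_normed_field) A n = (\<Sum>i\<in>A. f i n)"
  by (induction A rule: infinite_finite_induct) auto

text \<open>\<open>coord_le\<close> makes the supremum definite and the coordinate functionals
  uniformly bounded. \<open>p_tendsto\<close> lets estimates survive coordinatewise limits, which
  gives completeness. \<open>p_unit\<close> bounds the unit vectors and, through subadditivity,
  every finitely supported sequence uniformly in \<open>i\<close>.\<close>

locale seminorm_family =
  fixes p :: "'i \<Rightarrow> (nat \<Rightarrow> 'k::{real_normed_field,banach}) \<Rightarrow> real" and L D :: real
  assumes p_add: "p i (v + w) \<le> p i v + p i w"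
    and p_scale: "p i (seq_scale c v) = norm c * p i v"
    and p_tendsto: "(\<And>n. (\<lambda>k. u k n) \<longlonglongrightarrow> v n) \<Longrightarrow> (\<lambda>k. p i (u k)) \<longlonglongrightarrow> p i v"
    and L_nonneg: "0 \<le> L"
    and coord_le: "\<exists>i. \<forall>v. norm (v n) \<le> L * p i v"
    and p_unit: "p i (unit_seq n) \<le> D"
begin

definition N :: "(nat \<Rightarrow> 'k) \<Rightarrow> real" where
  "N v = (SUP i. p i v)"

text \<open>The closure of the finitely supported sequences. It is phrased through all
  \<open>p i\<close> at once because \<open>N\<close>, a bare supremum, carries no information
  before the family is known to be bounded at \<open>v\<close>.\<close>

definition X :: "(nat \<Rightarrow> 'k) set" where
  "X = {v. \<forall>e>0. \<exists>b. finite {n. b n \<noteq> 0} \<and> (\<forall>i. p i (v - b) \<le> e)}"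

lemma p_zero: "p i 0 = 0"
proof -
  have "seq_scale 0 0 = (0 :: nat \<Rightarrow> 'k)" by (simp add: seq_scale_def fun_eq_iff)
  with p_scale[of i 0 0] show ?thesis by simp
qed

lemma p_uminus: "p i (- v) = p i v"
proof -
  have "seq_scale (-1) v = - v" by (simp add: seq_scale_def fun_eq_iff)
  with p_scale[of i "-1" v] show ?thesis by simp
qed

lemma p_diff_commute: "p i (v - w) = p i (w - v)"
  using p_uminus[of i "v - w"] by simp

lemma p_nonneg: "0 \<le> p i v"
  using p_add[of i v "- v"] p_zero[of i] p_uminus[of i v] by simp

lemma p_sum: "p i (\<Sum>j\<in>A. f j) \<le> (\<Sum>j\<in>A. p i (f j))"
proof (induction A rule: infinite_finite_induct)
  case (insert x F)
  have "p i (f x + sum f F) \<le> p i (f x) + (\<Sum>j\<in>F. p i (f j))"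
    using p_add[of i "f x" "sum f F"] insert.IH by linarith
  then show ?case using insert.hyps by (simp only: sum.insert not_False_eq_True)
qed (simp_all only: sum.infinite sum.empty p_zero order_refl not_False_eq_True)

lemma finite_support_expand:
  assumes "finite A" "\<And>n. n \<notin> A \<Longrightarrow> b n = (0::'k)"
  shows "b = (\<Sum>n\<in>A. seq_scale (b n) (unit_seq n))"
proof
  fix m
  have "(\<Sum>n\<in>A. b n * unit_seq n m) = (\<Sum>n\<in>A. if n = m then b n else 0)"
    by (intro sum.cong) (auto simp: unit_seq_def)
  then show "b m = (\<Sum>n\<in>A. seq_scale (b n) (unit_seq n)) m"
    using assms by (simp add: sum_seq_apply seq_scale_def)
qed

lemma p_finite_support_le:
  assumes "finite A"
  shows "p i (\<Sum>n\<in>A. seq_scale (b n) (unit_seq n)) \<le> (\<Sum>n\<in>A. norm (b n)) * D"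
proof -
  have "p i (\<Sum>n\<in>A. seq_scale (b n) (unit_seq n)) \<le> (\<Sum>n\<in>A. norm (b n) * p i (unit_seq n))"
    using p_sum[of i "\<lambda>n. seq_scale (b n) (unit_seq n)" A] by (simp add: p_scale)
  also have "\<dots> \<le> (\<Sum>n\<in>A. norm (b n) * D)"
    by (intro sum_mono mult_left_mono p_unit) auto
  finally show ?thesis by (simp add: sum_distrib_right)
qed

text \<open>This makes \<open>N\<close> a genuine supremum on \<open>X\<close>: \<open>v\<close> is
  within 1 of a finitely supported \<open>b\<close>, and \<open>p i b\<close> is at most
  \<open>D\<close> times the l1 norm of \<open>b\<close>, for every \<open>i\<close>.\<close>

lemma bdd_above_p:
  assumes "v \<in> X"
  shows "bdd_above (range (\<lambda>i. p i v))"
proof -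
  obtain b where b: "finite {n. b n \<noteq> 0}" "\<And>i. p i (v - b) \<le> 1"
    using assms unfolding X_def by (auto dest: spec[of _ 1])
  have "p i v \<le> 1 + (\<Sum>n\<in>{n. b n \<noteq> 0}. norm (b n)) * D" for i
  proof -
    have "b = (\<Sum>n\<in>{n. b n \<noteq> 0}. seq_scale (b n) (unit_seq n))"
      using b(1) by (intro finite_support_expand) auto
    then have "p i b \<le> (\<Sum>n\<in>{n. b n \<noteq> 0}. norm (b n)) * D"
      using p_finite_support_le[OF b(1), of i b] by simp
    then show ?thesis using p_add[of i "v - b" b] b(2)[of i] by simp
  qed
  then show ?thesis by (intro bdd_aboveI) auto
qed

lemma p_le_N: "v \<in> X \<Longrightarrow> p i v \<le> N v"
  unfolding N_def by (intro cSUP_upper bdd_above_p) auto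

lemma N_le: "(\<And>i. p i v \<le> c) \<Longrightarrow> N v \<le> c"
  unfolding N_def by (intro cSUP_least) auto

lemma finite_support_in_X: "finite {n. b n \<noteq> 0} \<Longrightarrow> b \<in> X"
  unfolding X_def by (auto intro!: exI[of _ b] simp: p_zero)

lemma X_add: assumes "v \<in> X" "w \<in> X" shows "v + w \<in> X"
  unfolding X_def
proof (intro CollectI allI impI)
  fix e :: real assume "e > 0"
  then have "e / 2 > 0" by simp
  then obtain b c where b: "finite {n. b n \<noteq> 0}" "\<And>i. p i (v - b) \<le> e / 2"
    and c: "finite {n. c n \<noteq> 0}" "\<And>i. p i (w - c) \<le> e / 2"
    using assms unfolding X_def by blast
  have "finite {n. (b + c) n \<noteq> 0}"
    by (rule finite_subset[OF _ finite_UnI[OF b(1) c(1)]]) auto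
  moreover have "p i (v + w - (b + c)) \<le> e" for i
    using p_add[of i "v - b" "w - c"] b(2)[of i] c(2)[of i] by (simp add: algebra_simps)
  ultimately show "\<exists>b. finite {n. b n \<noteq> 0} \<and> (\<forall>i. p i (v + w - b) \<le> e)" by blast
qed

lemma X_scale: assumes "v \<in> X" shows "seq_scale c v \<in> X"
  unfolding X_def
proof (intro CollectI allI impI)
  fix e :: real assume "e > 0"
  \<comment> \<open>Adding 1 covers \<open>c = 0\<close> as well.\<close>
  then have "e / (norm c + 1) > 0" by (simp add: add_nonneg_pos)
  then obtain b where b: "finite {n. b n \<noteq> 0}" "\<And>i. p i (v - b) \<le> e / (norm c + 1)"
    using assms unfolding X_def by blast
  have "finite {n. seq_scale c b n \<noteq> 0}"
    by (rule finite_subset[OF _ b(1)]) (auto simp: seq_scale_def)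
  moreover have "p i (seq_scale c v - seq_scale c b) \<le> e" for i
  proof -
    have "seq_scale c v - seq_scale c b = seq_scale c (v - b)"
      by (simp add: seq_scale_def fun_eq_iff algebra_simps)
    then have "p i (seq_scale c v - seq_scale c b) = norm c * p i (v - b)"
      by (simp add: p_scale)
    also have "\<dots> \<le> (norm c + 1) * p i (v - b)"
      by (intro mult_right_mono p_nonneg) auto
    also have "\<dots> \<le> (norm c + 1) * (e / (norm c + 1))"
      by (intro mult_left_mono b) auto
    also have "\<dots> = e" by (simp add: add_nonneg_eq_0_iff)
    finally show ?thesis .
  qed
  ultimately show "\<exists>b. finite {n. b n \<noteq> 0} \<and> (\<forall>i. p i (seq_scale c v - b) \<le> e)" by blast
qed

lemma norm_coord_le:
  assumes "v \<in> X"
  shows "norm (v n) \<le> L * N v"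
proof -
  obtain i where "norm (v n) \<le> L * p i v" using coord_le by blast
  also have "\<dots> \<le> L * N v" by (intro mult_left_mono p_le_N assms L_nonneg)
  finally show ?thesis .
qed

lemma N_nonneg': "v \<in> X \<Longrightarrow> 0 \<le> N v"
  using p_nonneg p_le_N order_trans by blast

sublocale normed_carrier seq_scale X N
proof (intro normed_carrier.intro vector_space_seq_scale, unfold_locales)
  interpret V: vector_space "seq_scale :: 'k \<Rightarrow> _" by (rule vector_space_seq_scale)
  show "V.subspace X"
    unfolding V.subspace_def using X_add X_scale finite_support_in_X[of 0] by auto
  fix v w :: "nat \<Rightarrow> 'k" and c :: 'k
  assume v: "v \<in> X"
  show "0 \<le> N v" by (rule N_nonneg'[OF v])
  show "N v = 0 \<longleftrightarrow> v = 0"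
  proof
    assume "N v = 0"
    then show "v = 0" using norm_coord_le[OF v] by (simp add: fun_eq_iff)
  next
    assume "v = 0"
    then show "N v = 0" by (simp add: N_def p_zero)
  qed
  show "N (seq_scale c v) = norm c * N v"
  proof (rule antisym)
    show "N (seq_scale c v) \<le> norm c * N v"
      by (intro N_le) (auto simp: p_scale intro!: mult_left_mono p_le_N v)
    show "norm c * N v \<le> N (seq_scale c v)"
    proof (cases "c = 0")
      case False
      have "p i v \<le> N (seq_scale c v) / norm c" for i
        using p_le_N[OF X_scale[OF v], of i c] False by (simp add: p_scale field_simps)
      then have "N v \<le> N (seq_scale c v) / norm c" by (rule N_le)
      then show ?thesis using False by (simp add: field_simps)
    qed (use N_nonneg'[OF X_scale[OF v, of c]] in simp)
  qed
  assume w: "w \<in> X"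
  show "N (v + w) \<le> N v + N w"
    by (intro N_le order_trans[OF p_add] add_mono p_le_N v w)
qed

section \<open>Completeness\<close>

lemma p_diff_le_N: "v \<in> X \<Longrightarrow> w \<in> X \<Longrightarrow> p i (v - w) \<le> N (v - w)"
  by (intro p_le_N subspace_diff subspace_X)

text \<open>Bounded coordinate functionals turn a Cauchy sequence into coordinatewise Cauchy
  sequences of scalars. Their limit is the only candidate, and the Cauchy estimate passes to it one
  seminorm at a time.\<close>

lemma MCauchy_limit:
  assumes "metric.MCauchy u"
  obtains v where "v \<in> X" "\<And>e. e > 0 \<Longrightarrow> \<exists>k0. \<forall>k\<ge>k0. N (u k - v) \<le> e"
proof -
  have uX: "u k \<in> X" for k
    using assms by (auto simp: metric.MCauchy_def)
  have cau: "\<exists>k0. \<forall>k\<ge>k0. \<forall>l\<ge>k0. N (u k - u l) < e" if "e > 0" for e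
    using assms that uX unfolding metric.MCauchy_def by (simp add: ndist_def)
  have "Cauchy (\<lambda>k. u k n)" for n
  proof (rule CauchyI)
    fix e :: real assume e: "e > 0"
    have "e / (L + 1) > 0" using e L_nonneg by simp
    then obtain k0 where k0: "\<forall>k\<ge>k0. \<forall>l\<ge>k0. N (u k - u l) < e / (L + 1)"
      using cau by blast
    have "norm (u k n - u l n) < e" if "k \<ge> k0" "l \<ge> k0" for k l
    proof -
      have "norm (u k n - u l n) \<le> L * N (u k - u l)"
        using norm_coord_le[OF subspace_diff[OF subspace_X uX uX], of k l n] by simp
      also have "\<dots> \<le> (L + 1) * N (u k - u l)"
        by (intro mult_right_mono N_nonneg subspace_diff subspace_X uX) auto
      also have "\<dots> < (L + 1) * (e / (L + 1))"
        using k0 that L_nonneg by (intro mult_strict_left_mono) auto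
      finally show ?thesis using L_nonneg by simp
    qed
    then show "\<exists>k0. \<forall>k\<ge>k0. \<forall>l\<ge>k0. norm (u k n - u l n) < e" by blast
  qed
  then have "\<forall>n. \<exists>z. (\<lambda>k. u k n) \<longlonglongrightarrow> z"
    using Cauchy_convergent_iff convergent_def by blast
  then obtain v where v: "\<And>n. (\<lambda>k. u k n) \<longlonglongrightarrow> v n"
    by metis
  have lim: "\<exists>k0. \<forall>k\<ge>k0. \<forall>i. p i (u k - v) \<le> e" if e: "e > 0" for e
  proof -
    obtain k0 where k0: "\<forall>k\<ge>k0. \<forall>l\<ge>k0. N (u k - u l) < e"
      using cau[OF e] by blast
    \<comment> \<open>With \<open>k\<close> fixed let \<open>l\<close> tend to infinity. As
      \<open>k0\<close> comes from the estimate for \<open>N\<close>, it is the same for all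
      \<open>i\<close>.\<close>
    have "p i (u k - v) \<le> e" if "k \<ge> k0" for i k
    proof (rule tendsto_upperbound)
      show "(\<lambda>l. p i (u k - u l)) \<longlonglongrightarrow> p i (u k - v)"
        by (rule p_tendsto) (auto intro!: tendsto_intros v)
      show "\<forall>\<^sub>F l in sequentially. p i (u k - u l) \<le> e"
        using eventually_ge_at_top[of k0]
      proof eventually_elim
        case (elim l)
        then show ?case
          using p_diff_le_N[OF uX uX, of i k l] k0 that by fastforce
      qed
    qed auto
    then show ?thesis by blast
  qed
  have vX: "v \<in> X"
    unfolding X_def
  proof (intro CollectI allI impI)
    fix e :: real assume "e > 0"
    then have "e / 2 > 0" by simp
    obtain k where k: "\<And>i. p i (u k - v) \<le> e / 2" using lim[OF \<open>e / 2 > 0\<close>] by blast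
    obtain b where b: "finite {n. b n \<noteq> 0}" "\<And>i. p i (u k - b) \<le> e / 2"
      using uX[of k] \<open>e / 2 > 0\<close> unfolding X_def by blast
    have "p i (v - b) \<le> e" for i
      using p_add[of i "v - u k" "u k - b"] k[of i] b(2)[of i] p_diff_commute[of i v "u k"]
      by simp
    then show "\<exists>b. finite {n. b n \<noteq> 0} \<and> (\<forall>i. p i (v - b) \<le> e)" using b(1) by blast
  qed
  have "\<exists>k0. \<forall>k\<ge>k0. N (u k - v) \<le> e" if e: "e > 0" for e
  proof -
    obtain k0 where "\<forall>k\<ge>k0. \<forall>i. p i (u k - v) \<le> e" using lim[OF e] by blast
    then show ?thesis by (intro exI[of _ k0] allI impI N_le) simp
  qed
  then show ?thesis by (rule that[OF vX])
qed

sublocale banach_carrier seq_scale X N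
proof unfold_locales
  show "metric.mcomplete"
    unfolding metric.mcomplete_def
  proof (intro allI impI)
    fix u assume u: "metric.MCauchy u"
    have uX: "u k \<in> X" for k using u by (auto simp: metric.MCauchy_def)
    obtain v where v: "v \<in> X" "\<And>e. e > 0 \<Longrightarrow> \<exists>k0. \<forall>k\<ge>k0. N (u k - v) \<le> e"
      using MCauchy_limit[OF u] by blast
    have "\<exists>k0. \<forall>k\<ge>k0. u k \<in> X \<and> ndist (u k) v < e" if e: "e > 0" for e
    proof -
      \<comment> \<open>Halving turns the non-strict estimate into the strict one of metric
        convergence.\<close>
      have "e / 2 > 0" using e by simp
      then obtain k0 where "\<forall>k\<ge>k0. N (u k - v) \<le> e / 2" using v(2) by blast
      then have "u k \<in> X \<and> ndist (u k) v < e" if "k \<ge> k0" for k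
        using that e uX v(1) by (auto simp: ndist_def simp del: minus_apply dest!: spec[of _ k])
      then show ?thesis by blast
    qed
    then show "\<exists>v. limitin metric.mtopology u v sequentially"
      using v(1) unfolding metric.limit_metric_sequentially by blast
  qed
qed

section \<open>The unit vectors as a basis\<close>

lemma unit_in_X: "unit_seq n \<in> X"
  by (rule finite_support_in_X) (simp add: unit_seq_def)

lemma N_unit_le: "N (unit_seq n) \<le> D"
  by (intro N_le p_unit)

lemma dual_norm_le:
  assumes "0 \<le> c" "\<And>v. v \<in> X \<Longrightarrow> norm (f v) \<le> c * N v"
  shows "dual_norm f \<le> c"
  unfolding op_norm_def
proof (rule cSUP_least)
  show "{v \<in> X. N v \<le> 1} \<noteq> {}"
    using subspace_0[OF subspace_X] N_eq_0[of 0] by force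
  fix v assume "v \<in> {v \<in> X. N v \<le> 1}"
  then have "norm (f v) \<le> c * N v" "c * N v \<le> c * 1"
    using assms by (auto simp del: mult_1_right intro: mult_left_mono)
  then show "norm (f v) \<le> c" by simp
qed

text \<open>The coordinate functionals are cut off outside \<open>X\<close> because
  \<open>dual\<close> represents a functional by its extension by 0.\<close>

lemma biorthogonal_unit:
  "biorthogonal_seq unit_seq (\<lambda>n v. if v \<in> X then v n else 0)"
proof -
  have "(\<lambda>v. if v \<in> X then v n else 0) \<in> dual" for n
    unfolding dual_def using norm_coord_le[of _ n]
    by (auto simp: X_add X_scale) (auto simp: seq_scale_def intro!: exI[of _ L])
  moreover have "dual_norm (\<lambda>v. if v \<in> X then v n else 0) \<le> L" for n
    by (rule dual_norm_le) (auto simp: L_nonneg norm_coord_le)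
  ultimately show ?thesis
    unfolding biorthogonal_seq_def by (auto simp: unit_in_X) (auto simp: unit_seq_def)
qed

lemma finite_support_in_span:
  assumes "finite {n. b n \<noteq> 0}"
  shows "b \<in> span (range unit_seq)"
proof -
  have "b = (\<Sum>n\<in>{n. b n \<noteq> 0}. seq_scale (b n) (unit_seq n))"
    using assms by (intro finite_support_expand) auto
  also have "\<dots> \<in> span (range unit_seq)"
    by (intro span_sum span_scale span_base) auto
  finally show ?thesis .
qed

lemma is_basis_unit: "is_basis unit_seq"
  unfolding is_basis_def
proof (intro conjI)
  show "range unit_seq \<subseteq> X" using unit_in_X by auto
  show "\<exists>C. \<forall>n. N (unit_seq n) \<le> C" using N_unit_le by blast
  show "\<exists>xs. biorthogonal_seq unit_seq xs" using biorthogonal_unit by blast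
  show "metric.mtopology closure_of span (range unit_seq) = X"
  proof (rule antisym)
    show "metric.mtopology closure_of span (range unit_seq) \<subseteq> X"
      using closure_of_subset_topspace[of metric.mtopology] by simp
    \<comment> \<open>Density is built into \<open>X\<close>: the approximating sequences in its
      definition are finite combinations of unit vectors.\<close>
    show "X \<subseteq> metric.mtopology closure_of span (range unit_seq)"
    proof
      fix v assume v: "v \<in> X"
      have "\<exists>y\<in>span (range unit_seq). y \<in> metric.mball v r" if "r > 0" for r
      proof -
        have "r / 2 > 0" using that by simp
        then obtain b where b: "finite {n. b n \<noteq> 0}" "\<And>i. p i (v - b) \<le> r / 2"
          using v unfolding X_def by blast
        then have "b \<in> X" "N (v - b) \<le> r / 2"
          by (blast intro: finite_support_in_X N_le)+
        then have "b \<in> metric.mball v r"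
          using v that by (simp add: ndist_def)
        then show ?thesis using finite_support_in_span[OF b(1)] by blast
      qed
      then show "v \<in> metric.mtopology closure_of span (range unit_seq)"
        using v unfolding metric.metric_closure_of by blast
    qed
  qed
qed

lemma coord_unit: "coord unit_seq n v = (if v \<in> X then v n else 0)"
  using coord_eq[OF is_basis_unit biorthogonal_unit] by simp

lemma coord_proj_unit:
  assumes "v \<in> X" "finite A"
  shows "coord_proj unit_seq A v = (\<lambda>n. if n \<in> A then v n else 0)"
proof -
  have "(\<lambda>n. if n \<in> A then v n else 0)
      = (\<Sum>n\<in>A. seq_scale (if n \<in> A then v n else 0) (unit_seq n))"
    using assms by (intro finite_support_expand) auto
  also have "\<dots> = coord_proj unit_seq A v"
    unfolding coord_proj_def using assms by (intro sum.cong) (auto simp: coord_unit)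
  finally show ?thesis by simp
qed

lemma sum_unit_seq:
  "finite A \<Longrightarrow> (\<Sum>k\<in>A. unit_seq k) = (\<lambda>n. if n \<in> A then 1 else (0::'k))"
  by (simp add: fun_eq_iff sum_seq_apply unit_seq_def)

text \<open>Passes from suprema over the unit ball to a homogeneous inequality by normalising
  \<open>v\<close>.\<close>

lemma unconditional_bound:
  assumes "unconditional unit_seq"
  obtains K where "\<And>A v. finite A \<Longrightarrow> v \<in> X \<Longrightarrow> N (coord_proj unit_seq A v) \<le> K * N v"
proof -
  obtain K where K: "\<And>A. finite A \<Longrightarrow> op_norm N (coord_proj unit_seq A) \<le> K"
    using assms unfolding unconditional_def bdd_above_def by auto
  have "N (coord_proj unit_seq A v) \<le> K * N v" if A: "finite A" and v: "v \<in> X" for A v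
  proof (cases "v = 0")
    case True
    then have "coord_proj unit_seq A v = 0"
      using coord_proj_unit[OF v A] by (simp add: fun_eq_iff)
    then show ?thesis using True N_eq_0[of 0] v by simp
  next
    case False
    then have Npos: "N v > 0" using N_eq_0[OF v] N_nonneg[OF v] by linarith
    let ?c = "of_real (1 / N v) :: 'k"
    have cv: "seq_scale ?c v \<in> X" by (rule X_scale[OF v])
    have N1: "N (seq_scale ?c v) = 1" using Npos by (simp add: N_scale[OF v] norm_divide)
    \<comment> \<open>A value lies below \<open>op_norm\<close> only once the supremum is known to
      be finite. On the unit ball every coordinate is at most \<open>L\<close>, so the projection
      has norm at most \<open>card A * L * D\<close>.\<close>
    have bdd: "bdd_above ((\<lambda>v. N (coord_proj unit_seq A v)) ` {v \<in> X. N v \<le> 1})"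
    proof (rule bdd_aboveI2)
      fix u assume u: "u \<in> {v \<in> X. N v \<le> 1}"
      have D: "0 \<le> D" using order_trans[OF p_nonneg p_unit] .
      have "norm (u n) \<le> L" for n
      proof -
        have "norm (u n) \<le> L * N u" using u norm_coord_le by simp
        also have "\<dots> \<le> L * 1" using u L_nonneg by (intro mult_left_mono) auto
        finally show ?thesis by simp
      qed
      then have "(\<Sum>n\<in>A. norm (u n)) * D \<le> (\<Sum>n\<in>A. L) * D"
        by (intro mult_right_mono sum_mono D)
      moreover have "coord_proj unit_seq A u = (\<Sum>n\<in>A. seq_scale (u n) (unit_seq n))"
        using u unfolding coord_proj_def by (simp add: coord_unit)
      ultimately show "N (coord_proj unit_seq A u) \<le> (\<Sum>n\<in>A. L) * D"
        using p_finite_support_le[OF A, of _ u] by (metis N_le order_trans)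
    qed
    have "N (coord_proj unit_seq A (seq_scale ?c v)) \<le> op_norm N (coord_proj unit_seq A)"
      unfolding op_norm_def using cv N1 by (intro cSUP_upper bdd) auto
    also have "\<dots> \<le> K" by (rule K[OF A])
    also have "coord_proj unit_seq A (seq_scale ?c v) = seq_scale ?c (coord_proj unit_seq A v)"
      using A v cv by (simp add: coord_proj_unit seq_scale_def fun_eq_iff)
    also have "N \<dots> = N (coord_proj unit_seq A v) / N v"
    proof -
      have "coord_proj unit_seq A v \<in> X"
        using A v by (intro finite_support_in_X) (auto simp: coord_proj_unit)
      then show ?thesis using Npos by (simp add: N_scale norm_divide)
    qed
    finally show ?thesis using Npos by (simp add: field_simps)
  qed
  then show ?thesis using that by blast
qed

end

section \<open>Weights on blocks\<close>

text \<open>Outside their intersection, \<open>A\<close> and the initial segment have equally many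
  elements. There the terms of \<open>A\<close> are at most \<open>w (card A)\<close> and those of
  the segment at least that.\<close>

lemma sum_antimono_le_initial:
  fixes w :: "nat \<Rightarrow> real"
  assumes w: "antimono w" and A: "finite A"
  shows "sum w A \<le> sum w {..<card A}"
proof -
  let ?m = "card A"
  have c: "card (A - {..<?m}) = card ({..<?m} - A)"
    using A card_Diff_subset_Int[of A "{..<?m}"] card_Diff_subset_Int[of "{..<?m}" A]
    by (simp add: Int_commute)
  have "sum w (A - {..<?m}) \<le> of_nat (card (A - {..<?m})) * w ?m"
    by (intro sum_bounded_above antimonoD[OF w]) auto
  also have "\<dots> = of_nat (card ({..<?m} - A)) * w ?m" by (simp only: c)
  also have "\<dots> \<le> sum w ({..<?m} - A)"
    by (intro sum_bounded_below antimonoD[OF w]) auto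
  finally have "sum w (A - {..<?m}) + sum w (A \<inter> {..<?m})
      \<le> sum w ({..<?m} - A) + sum w (A \<inter> {..<?m})" by simp
  then show ?thesis
    using sum.Int_Diff[OF A, of w "{..<?m}"] sum.Int_Diff[of "{..<?m}" w A]
    by (simp add: Int_commute add.commute)
qed

text \<open>Splitting off the first term leaves \<open>d 0\<close> minus an alternating sum of the
  shifted sequence, so the induction runs over all \<open>d\<close> simultaneously.\<close>

lemma alternating_sum_bounds:
  fixes d :: "nat \<Rightarrow> real"
  assumes "antimono d" "\<And>n. 0 \<le> d n"
  shows "0 \<le> (\<Sum>n<m. (-1) ^ n * d n) \<and> (\<Sum>n<m. (-1) ^ n * d n) \<le> d 0"
  using assms
proof (induction m arbitrary: d)
  case (Suc m)
  have "antimono (\<lambda>n. d (Suc n))"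
    using Suc.prems(1) by (simp add: antimono_def)
  then have "0 \<le> (\<Sum>n<m. (-1) ^ n * d (Suc n)) \<and> (\<Sum>n<m. (-1) ^ n * d (Suc n)) \<le> d 1"
    using Suc.IH[of "\<lambda>n. d (Suc n)"] Suc.prems(2) by simp
  moreover have "(\<Sum>n<Suc m. (-1) ^ n * d n) = d 0 - (\<Sum>n<m. (-1) ^ n * d (Suc n))"
    by (simp add: sum.lessThan_Suc_shift sum_negf del: sum.lessThan_Suc)
  moreover have "d 1 \<le> d 0" using Suc.prems(1) by (simp add: antimono_def)
  ultimately show ?case by linarith
qed simp

text \<open>Adding the alternating sum doubles the even terms and cancels the odd ones, and that
  alternating sum is nonnegative.\<close>

lemma sum_even_ge_half:
  fixes d :: "nat \<Rightarrow> real"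
  assumes "antimono d" "\<And>n. 0 \<le> d n"
  shows "(\<Sum>n<m. d n) \<le> 2 * (\<Sum>n\<in>{n. n < m \<and> even n}. d n)"
proof -
  have "(\<Sum>n\<in>{n. n < m \<and> even n}. d n) = (\<Sum>n<m. if even n then d n else 0)"
    by (rule sum.mono_neutral_cong_left) auto
  then have "2 * (\<Sum>n\<in>{n. n < m \<and> even n}. d n) = (\<Sum>n<m. d n + (-1) ^ n * d n)"
    by (simp add: sum_distrib_left) (intro sum.cong; auto)
  then show ?thesis using alternating_sum_bounds[OF assms, of m] by (simp add: sum.distrib)
qed

section \<open>Blocks with at least doubling ends\<close>

locale doubling_blocks =
  fixes q :: "nat \<Rightarrow> nat"
  assumes q_pos: "1 \<le> q 0" and q_double: "2 * q k \<le> q (Suc k)"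
begin

lemma q_ge_1: "1 \<le> q k"
proof (induction k)
  case (Suc k)
  then show ?case using q_double[of k] by simp
qed (rule q_pos)

lemma q_strict_mono: "strict_mono q"
  unfolding strict_mono_Suc_iff
proof
  fix k show "q k < q (Suc k)" using q_ge_1[of k] q_double[of k] by simp
qed

lemma q_unbounded: "k \<le> q k"
  by (rule strict_mono_imp_increasing[OF q_strict_mono])

text \<open>The blocks are \<open>[0, q 0)\<close> and \<open>[q k, q (Suc k))\<close>; the value is
  the excluded right end of the block containing \<open>n\<close>.\<close>

definition block_end :: "nat \<Rightarrow> nat" where
  "block_end n = q (LEAST k. n < q k)"

lemma block_end_gt: "n < block_end n"
  unfolding block_end_def by (rule LeastI[of _ "Suc n"]) (use q_unbounded[of "Suc n"] in simp)

lemma block_end_ge_1: "1 \<le> block_end n"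
  using block_end_gt[of n] by simp

lemma block_end_mono: "n \<le> m \<Longrightarrow> block_end n \<le> block_end m"
  unfolding block_end_def
  using block_end_gt[of m] strict_mono_mono[OF q_strict_mono]
  by (intro monoD[of q] Least_le) (auto simp: block_end_def)

lemma block_end_first: "n < q 0 \<Longrightarrow> block_end n = q 0"
  unfolding block_end_def by (subst Least_equality[of _ 0]) auto

lemma block_end_Suc: "q k \<le> n \<Longrightarrow> n < q (Suc k) \<Longrightarrow> block_end n = q (Suc k)"
  unfolding block_end_def
proof (subst Least_equality[of _ "Suc k"])
  fix j assume "q k \<le> n" "n < q j"
  then have "q k < q j" by simp
  then show "Suc k \<le> j" using strict_mono_less[OF q_strict_mono] by simp
qed auto

text \<open>On the block ending at \<open>r\<close> the summand is the constant
  \<open>u r / r\<close>, and \<open>l\<close> such terms with \<open>l \<le> r\<close> add up to at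
  most \<open>u l\<close> since \<open>u m / m\<close> is nonincreasing. By doubling, complete
  blocks form a geometric sum of at most \<open>2 * u (q k)\<close>; the last partial block adds
  \<open>u m\<close>. The lemma serves both \<open>s\<close> and \<open>m / s m\<close>.\<close>

lemma sum_block_ratio_le:
  fixes u :: "nat \<Rightarrow> real"
  assumes pos: "\<And>m. m \<ge> 1 \<Longrightarrow> 0 < u m" and mono: "mono_on {1..} u"
    and ratio: "mono_on {1..} (\<lambda>m. real m / u m)"
    and double: "\<And>k. 2 * u (q k) \<le> u (q (Suc k))" and m: "m \<ge> 1"
  shows "(\<Sum>n<m. u (block_end n) / real (block_end n)) \<le> 3 * u m"
proof -
  let ?w = "\<lambda>n. u (block_end n) / real (block_end n)"
  have anti: "real l * (u r / real r) \<le> u l" if "1 \<le> l" "l \<le> r" for l r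
    using mono_onD[OF ratio, of l r] that pos[of l] pos[of r] by (simp add: field_simps)
  have step: "(\<Sum>n=q k..<l. ?w n) \<le> u l" if l: "q k \<le> l" "l \<le> q (Suc k)" for k l
  proof -
    have "(\<Sum>n=q k..<l. ?w n) = (\<Sum>n=q k..<l. u (q (Suc k)) / real (q (Suc k)))"
      using l by (intro sum.cong) (auto simp: block_end_Suc)
    also have "\<dots> = real (l - q k) * (u (q (Suc k)) / real (q (Suc k)))" by simp
    also have "\<dots> \<le> real l * (u (q (Suc k)) / real (q (Suc k)))"
      using pos[OF q_ge_1, of "Suc k"] by (intro mult_right_mono divide_nonneg_nonneg) auto
    also have "\<dots> \<le> u l" using l q_ge_1[of k] by (intro anti) auto
    finally show ?thesis .
  qed
  have split: "(\<Sum>n<l. ?w n) = (\<Sum>n<q k. ?w n) + (\<Sum>n=q k..<l. ?w n)" if "q k \<le> l" for k l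
    using sum.atLeastLessThan_concat[of 0 "q k" l ?w] that
    by (simp only: atLeast0LessThan)
  have first: "(\<Sum>n<l. ?w n) \<le> u l" if "1 \<le> l" "l \<le> q 0" for l
  proof -
    have "(\<Sum>n<l. ?w n) = (\<Sum>n<l. u (q 0) / real (q 0))"
      using that by (intro sum.cong) (auto simp: block_end_first)
    also have "\<dots> = real l * (u (q 0) / real (q 0))" by simp
    also have "\<dots> \<le> u l" by (rule anti[OF that])
    finally show ?thesis .
  qed
  have ends: "(\<Sum>n<q k. ?w n) \<le> 2 * u (q k)" for k
  proof (induction k)
    case 0
    then show ?case using first[of "q 0"] q_pos pos[OF q_pos] by linarith
  next
    case (Suc k)
    have "q k \<le> q (Suc k)" using q_double[of k] by simp
    with Suc show ?case
      using split[of k "q (Suc k)"] step[of k "q (Suc k)"] double[of k] by linarith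
  qed
  show ?thesis
  proof (cases "m \<le> q 0")
    case True
    then show ?thesis using first[OF m] pos[OF m] by linarith
  next
    case False
    \<comment> \<open>\<open>q j\<close> is the first block end not below \<open>m\<close>; as
      \<open>m\<close> exceeds \<open>q 0\<close>, the index \<open>j\<close> has a predecessor,
      whose end lies below \<open>m\<close>.\<close>
    define j where "j = (LEAST k. m \<le> q k)"
    have j: "m \<le> q j" unfolding j_def by (rule LeastI[of _ m]) (rule q_unbounded)
    with False obtain k where k: "j = Suc k" by (cases j) auto
    have "\<not> m \<le> q k" using not_less_Least[of k "\<lambda>k. m \<le> q k"] k j_def by simp
    then have km: "q k \<le> m" by simp
    have "u (q k) \<le> u m" using mono_onD[OF mono] km q_ge_1[of k] by simp
    then show ?thesis
      using split[OF km] step[of k m] km ends[of k] j[unfolded k] by linarith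
  qed
qed

text \<open>The block from \<open>q k\<close> to \<open>q (Suc k)\<close> holds at least half of the
  indices below its end, hence contributes at least 1/2. This divergence is the source of
  conditionality.\<close>

lemma sum_inverse_block_end_ge: "real k / 2 \<le> (\<Sum>n<q k. 1 / real (block_end n))"
proof (induction k)
  case 0
  then show ?case by (simp add: sum_nonneg)
next
  case (Suc k)
  have le: "q k \<le> q (Suc k)" using q_double[of k] by simp
  have "(\<Sum>n=q k..<q (Suc k). 1 / real (block_end n))
      = (\<Sum>n=q k..<q (Suc k). 1 / real (q (Suc k)))"
    by (intro sum.cong) (auto simp: block_end_Suc)
  also have "\<dots> = (real (q (Suc k)) - real (q k)) / real (q (Suc k))"
    using le by (simp add: of_nat_diff)
  also have "\<dots> \<ge> 1 / 2"
    using q_ge_1[of "Suc k"] of_nat_mono[OF q_double[of k], where ?'a = real]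
    by (simp add: field_simps)
  finally have "(\<Sum>n=q k..<q (Suc k). 1 / real (block_end n)) \<ge> 1 / 2" .
  moreover have "(\<Sum>n<q (Suc k). 1 / real (block_end n))
      = (\<Sum>n<q k. 1 / real (block_end n)) + (\<Sum>n=q k..<q (Suc k). 1 / real (block_end n))"
    using sum.atLeastLessThan_concat[of 0 "q k" "q (Suc k)" "\<lambda>n. 1 / real (block_end n)"] le
    by (simp only: atLeast0LessThan)
  ultimately show ?case using Suc by simp
qed

end

section \<open>Choice of the block ends\<close>

lemma unbounded_mono_exceeds:
  fixes u :: "nat \<Rightarrow> real"
  assumes "mono_on {1..} u" "\<not> bdd_above (u ` {1..})"
  obtains r where "1 \<le> r" "\<And>m. r \<le> m \<Longrightarrow> c \<le> u m"
proof -
  obtain r where r: "1 \<le> r" "c < u r"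
    using assms(2) unfolding bdd_above_def by (auto simp: not_le)
  then have "c \<le> u m" if "r \<le> m" for m
    using mono_onD[OF assms(1), of r m] that by simp
  then show ?thesis using that r by blast
qed

text \<open>Each of the three growth conditions holds for all large successors of a given point, so
  one successor meets them all; iterating the choice from 1 gives \<open>q\<close>.\<close>

lemma exists_doubling_sequence:
  fixes s t :: "nat \<Rightarrow> real"
  assumes "mono_on {1..} s" "\<not> bdd_above (s ` {1..})"
    and "mono_on {1..} t" "\<not> bdd_above (t ` {1..})"
  obtains q where "doubling_blocks q"
    "\<And>k. 2 * s (q k) \<le> s (q (Suc k))" "\<And>k. 2 * t (q k) \<le> t (q (Suc k))"
proof -
  have "\<exists>r. 2 * x \<le> r \<and> 2 * s x \<le> s r \<and> 2 * t x \<le> t r" for x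
  proof -
    obtain a where a: "\<And>m. a \<le> m \<Longrightarrow> 2 * s x \<le> s m"
      using unbounded_mono_exceeds[OF assms(1,2)] by metis
    obtain b where b: "\<And>m. b \<le> m \<Longrightarrow> 2 * t x \<le> t m"
      using unbounded_mono_exceeds[OF assms(3,4)] by metis
    show ?thesis by (rule exI[of _ "2 * x + a + b"]) (simp add: a b)
  qed
  then obtain g where g: "\<And>x. 2 * x \<le> g x \<and> 2 * s x \<le> s (g x) \<and> 2 * t x \<le> t (g x)"
    by metis
  define q where "q k = (g ^^ k) 1" for k
  show ?thesis
    by (rule that[of q]) (use g in \<open>auto simp: q_def doubling_blocks_def\<close>)
qed

section \<open>The two weight sequences\<close>

locale fundamental_data = doubling_blocks q for q :: "nat \<Rightarrow> nat" +
  fixes s :: "nat \<Rightarrow> real"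
  assumes s_pos: "\<And>m. m \<ge> 1 \<Longrightarrow> 0 < s m"
    and s_mono: "mono_on {1..} s"
    and ratio_mono: "mono_on {1..} (\<lambda>m. real m / s m)"
    and s_double: "2 * s (q k) \<le> s (q (Suc k))"
    and ratio_double: "2 * (real (q k) / s (q k)) \<le> real (q (Suc k)) / s (q (Suc k))"
begin

definition w :: "nat \<Rightarrow> real" where
  "w n = s (block_end n) / real (block_end n)"

definition a :: "nat \<Rightarrow> real" where
  "a n = 1 / s (block_end n)"

lemma ratio_anti: "1 \<le> l \<Longrightarrow> l \<le> m \<Longrightarrow> s m / real m \<le> s l / real l"
  using mono_onD[OF ratio_mono, of l m] s_pos[of l] s_pos[of m] by (simp add: field_simps)

lemma w_nonneg: "0 \<le> w n"
  using s_pos[OF block_end_ge_1, of n] by (simp add: w_def)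

lemma a_nonneg: "0 \<le> a n"
  using s_pos[OF block_end_ge_1, of n] by (simp add: a_def)

lemma w_antimono: "antimono w"
  unfolding w_def by (intro antimonoI ratio_anti block_end_mono block_end_ge_1)

lemma a_antimono: "antimono a"
proof (rule antimonoI)
  fix n m :: nat assume "n \<le> m"
  then have "s (block_end n) \<le> s (block_end m)"
    using block_end_ge_1[of n] block_end_mono[of n m] by (intro mono_onD[OF s_mono]) auto
  then show "a m \<le> a n"
    unfolding a_def using s_pos[OF block_end_ge_1, of n] by (intro divide_left_mono) auto
qed

lemma sum_w_le: "1 \<le> m \<Longrightarrow> (\<Sum>n<m. w n) \<le> 3 * s m"
  unfolding w_def by (intro sum_block_ratio_le s_pos s_mono ratio_mono s_double) auto

lemma sum_a_le: "1 \<le> m \<Longrightarrow> (\<Sum>n<m. a n) \<le> 3 * (real m / s m)"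
proof -
  assume m: "1 \<le> m"
  \<comment> \<open>The hypotheses are symmetric under exchanging \<open>s\<close> and
    \<open>?t\<close>: \<open>m / ?t m\<close> is \<open>s m\<close> again, and
    \<open>?t r / r\<close> is \<open>1 / s r\<close>, the value of \<open>a\<close> on the block
    ending at \<open>r\<close>.\<close>
  let ?t = "\<lambda>m. real m / s m"
  have "mono_on {1..} (\<lambda>m. real m / ?t m)"
  proof (rule mono_onI)
    fix l r :: nat assume lr: "l \<in> {1..}" "r \<in> {1..}" "l \<le> r"
    then show "real l / ?t l \<le> real r / ?t r" using mono_onD[OF s_mono, of l r] by simp
  qed
  then have "(\<Sum>n<m. ?t (block_end n) / real (block_end n)) \<le> 3 * ?t m"
    using m s_pos by (intro sum_block_ratio_le ratio_mono ratio_double) auto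
  moreover have "?t (block_end n) / real (block_end n) = a n" for n
    using block_end_ge_1[of n] by (simp add: a_def)
  ultimately show ?thesis by simp
qed

text \<open>The empty set stands apart because nothing is assumed about \<open>s 0\<close>.\<close>

lemma sum_w_set_le:
  assumes "finite A"
  shows "A = {} \<or> sum w A \<le> 3 * s (card A)"
proof (cases "A = {}")
  case False
  then have "1 \<le> card A" using assms by (simp add: Suc_le_eq card_gt_0_iff)
  then show ?thesis
    using sum_antimono_le_initial[OF w_antimono assms] sum_w_le[of "card A"] by linarith
qed simp

text \<open>Bounds the Marcinkiewicz part of the norm for every sequence dominated by
  \<open>a\<close>.\<close>

lemma sum_a_set_le: "finite A \<Longrightarrow> s (card A) / real (card A) * sum a A \<le> 3"
proof (cases "A = {}")
  case False
  assume A: "finite A"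
  then have c: "1 \<le> card A" using False by (simp add: Suc_le_eq card_gt_0_iff)
  then have "sum a A \<le> 3 * (real (card A) / s (card A))"
    using sum_antimono_le_initial[OF a_antimono A] sum_a_le[of "card A"] by linarith
  then show ?thesis using s_pos[OF c] c by (simp add: field_simps)
qed simp

text \<open>The first \<open>m\<close> weights are all at least \<open>w m\<close>, while their sum
  is at most \<open>3 * s m\<close>.\<close>

lemma w_card_le: "1 \<le> m \<Longrightarrow> w m * (real m / s m) \<le> 3"
proof -
  assume m: "1 \<le> m"
  have "real m * w m \<le> (\<Sum>n<m. w n)"
    using sum_bounded_below[of "{..<m}" "w m" w] antimonoD[OF w_antimono] by auto
  also have "\<dots> \<le> 3 * s m" by (rule sum_w_le[OF m])
  finally show ?thesis using s_pos[OF m] by (simp add: field_simps)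
qed

lemma aw_eq: "w n * a n = 1 / real (block_end n)"
  using s_pos[OF block_end_ge_1, of n] by (simp add: w_def a_def)

section \<open>The Konyagin--Temlyakov type norm\<close>

text \<open>For infinite \<open>A\<close> the first summand is \<open>0\<close>, so the index set may be the whole type.\<close>

definition seminorm :: "nat set \<times> nat \<Rightarrow> (nat \<Rightarrow> 'k::{real_normed_field,banach}) \<Rightarrow> real" where
  "seminorm = (\<lambda>(A, m) v. s (card A) / real (card A) * (\<Sum>n\<in>A. norm (v n))
                  + norm (\<Sum>n<m. of_real (w n) * v n))"

text \<open>For empty or infinite \<open>A\<close> the denominator is 0 and so is the quotient,
  whatever the sign of \<open>s 0\<close>.\<close>

lemma marcinkiewicz_coeff_nonneg: "0 \<le> s (card A) / real (card A)"
  by (cases "card A = 0") (use s_pos[of "card A"] in auto)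

text \<open>The constant is 1 + 3. In the Marcinkiewicz part, a set \<open>B\<close> no larger than
  \<open>A\<close> gives at most \<open>s (card B)\<close>; for a larger \<open>B\<close> the
  coefficient is at most that of \<open>A\<close>, and at most \<open>card A\<close> terms are
  nonzero. The weighted part is at most the sum of \<open>w\<close> over \<open>A\<close>.\<close>

lemma seminorm_indicator_le:
  assumes A: "finite A" "A \<noteq> {}"
  shows "seminorm i (\<lambda>n. if n \<in> A then 1 else (0::'k::{real_normed_field,banach})) \<le> 4 * s (card A)"
proof -
  obtain B m where i: "i = (B, m)" by fastforce
  have cA: "1 \<le> card A" using A by (simp add: Suc_le_eq card_gt_0_iff)
  have "s (card B) / real (card B) * (\<Sum>n\<in>B. norm (if n \<in> A then 1 else (0::'k))) \<le> s (card A)"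
  proof (cases "card B = 0")
    case True
    then show ?thesis using s_pos[OF cA] by simp
  next
    case False
    then have fB: "finite B" and cB: "1 \<le> card B" by (auto intro: card_ge_0_finite)
    have "(\<Sum>n\<in>B. norm (if n \<in> A then 1 else (0::'k))) = (\<Sum>n\<in>B. if n \<in> A then 1 else 0)"
      by (intro sum.cong) auto
    also have "\<dots> = real (card (B \<inter> A))"
      using fB by (simp flip: sum.inter_restrict)
    finally have eq: "(\<Sum>n\<in>B. norm (if n \<in> A then 1 else (0::'k))) = real (card (B \<inter> A))" .
    have l: "card (B \<inter> A) \<le> card A" "card (B \<inter> A) \<le> card B"
      using A fB by (auto intro: card_mono)
    show ?thesis
    proof (cases "card B \<le> card A")
      case True
      have "s (card B) / real (card B) * real (card (B \<inter> A)) \<le> s (card B) / real (card B) * real (card B)"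
        using l by (intro mult_left_mono marcinkiewicz_coeff_nonneg) auto
      also have "\<dots> \<le> s (card A)" using mono_onD[OF s_mono, of "card B" "card A"] cB True by simp
      finally show ?thesis by (simp only: eq)
    next
      case False
      have "s (card B) / real (card B) * real (card (B \<inter> A)) \<le> s (card A) / real (card A) * real (card A)"
        using l cA False by (intro mult_mono ratio_anti marcinkiewicz_coeff_nonneg) auto
      also have "\<dots> = s (card A)" using cA by simp
      finally show ?thesis by (simp only: eq)
    qed
  qed
  moreover have "norm (\<Sum>n<m. of_real (w n) * (if n \<in> A then 1 else (0::'k))) \<le> 3 * s (card A)"
  proof -
    have "norm (\<Sum>n<m. of_real (w n) * (if n \<in> A then 1 else (0::'k)))
        \<le> (\<Sum>n<m. if n \<in> A then w n else 0)"
      by (rule sum_norm_le) (auto simp: w_nonneg)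
    also have "\<dots> = sum w ({..<m} \<inter> A)" by (simp add: sum.inter_restrict)
    also have "\<dots> \<le> sum w A" by (intro sum_mono2) (auto simp: A w_nonneg)
    also have "\<dots> \<le> 3 * s (card A)" using sum_w_set_le[OF A(1)] A(2) by simp
    finally show ?thesis .
  qed
  ultimately show ?thesis by (simp add: i seminorm_def)
qed

text \<open>The index \<open>({n}, 0)\<close> evaluates to \<open>s 1\<close> times the modulus of
  coordinate \<open>n\<close>, whence \<open>1 / s 1\<close>; \<open>4 * s 1\<close> is the
  indicator bound for a singleton.\<close>

sublocale F: seminorm_family "seminorm :: _ \<Rightarrow> (nat \<Rightarrow> 'k::{real_normed_field,banach}) \<Rightarrow> real"
  "1 / s 1" "4 * s 1"
proof unfold_locales
  fix i :: "nat set \<times> nat" and v u :: "nat \<Rightarrow> 'k" and c :: 'k and n :: nat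
  obtain A m where i: "i = (A, m)" by fastforce
  show "seminorm i (v + u) \<le> seminorm i v + seminorm i u"
  proof -
    have "s (card A) / real (card A) * (\<Sum>n\<in>A. norm (v n + u n))
        \<le> s (card A) / real (card A) * (\<Sum>n\<in>A. norm (v n) + norm (u n))"
      by (intro mult_left_mono sum_mono norm_triangle_ineq marcinkiewicz_coeff_nonneg)
    moreover have "norm (\<Sum>n<m. of_real (w n) * (v n + u n))
        \<le> norm (\<Sum>n<m. of_real (w n) * v n) + norm (\<Sum>n<m. of_real (w n) * u n)"
      by (simp add: distrib_left sum.distrib norm_triangle_ineq)
    ultimately show ?thesis by (simp add: i seminorm_def sum.distrib distrib_left)
  qed
  show "seminorm i (seq_scale c v) = norm c * seminorm i v"
  proof -
    have "(\<Sum>n<m. of_real (w n) * (c * v n)) = c * (\<Sum>n<m. of_real (w n) * v n)"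
      by (simp add: sum_distrib_left mult.left_commute)
    then show ?thesis
      by (simp add: i seminorm_def seq_scale_def norm_mult sum_distrib_left[symmetric] algebra_simps)
  qed
  show "0 \<le> 1 / s 1" using s_pos[of 1] by simp
  show "\<exists>i. \<forall>v::nat \<Rightarrow> 'k. norm (v n) \<le> 1 / s 1 * seminorm i v"
    using s_pos[of 1] by (intro exI[of _ "({n}, 0)"]) (simp add: seminorm_def)
  show "seminorm i (unit_seq n :: nat \<Rightarrow> 'k) \<le> 4 * s 1"
    using seminorm_indicator_le[of "{n}" i, where ?'k = 'k] by (simp add: unit_seq_def)
next
  fix i :: "nat set \<times> nat" and u :: "nat \<Rightarrow> nat \<Rightarrow> 'k" and v
  assume "\<And>n. (\<lambda>k. u k n) \<longlonglongrightarrow> v n"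
  then have "(\<lambda>k. s (card A) / real (card A) * (\<Sum>n\<in>A. norm (u k n))
            + norm (\<Sum>n<m. of_real (w n) * u k n))
      \<longlonglongrightarrow> s (card A) / real (card A) * (\<Sum>n\<in>A. norm (v n))
            + norm (\<Sum>n<m. of_real (w n) * v n)" for A m
    by (intro tendsto_add tendsto_mult tendsto_const tendsto_norm tendsto_sum)
  then show "(\<lambda>k. seminorm i (u k)) \<longlonglongrightarrow> seminorm i v"
    unfolding seminorm_def by (cases i) simp
qed

section \<open>The unit vector basis\<close>

text \<open>Fixing \<open>scalar_type\<close> keeps \<open>'k\<close> the same throughout the
  context; the results leave it polymorphic, ready for both scalar fields.\<close>

context
  fixes scalar_type :: "'k::{real_normed_field,banach} itself"
begin

abbreviation "basis \<equiv> (unit_seq :: nat \<Rightarrow> nat \<Rightarrow> 'k)"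

section \<open>Fundamental functions and bidemocracy\<close>

lemma norm_weighted_sum_le_N:
  assumes "v \<in> F.X"
  shows "norm (\<Sum>n<m. of_real (w n) * v n :: 'k) \<le> F.N v"
  using F.p_le_N[OF assms, of "({}, m)"] by (simp add: seminorm_def)

lemma sum_norm_le_N:
  fixes v :: "nat \<Rightarrow> 'k"
  assumes "v \<in> F.X" "finite A" "A \<noteq> {}"
  shows "(\<Sum>n\<in>A. norm (v n)) \<le> real (card A) / s (card A) * F.N v"
proof -
  have c: "1 \<le> card A" using assms by (simp add: Suc_le_eq card_gt_0_iff)
  have "s (card A) / real (card A) * (\<Sum>n\<in>A. norm (v n)) \<le> F.N v"
    using F.p_le_N[OF assms(1), of "(A, 0)"] by (simp add: seminorm_def)
  then show ?thesis using s_pos[OF c] c by (simp add: field_simps)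
qed

lemma N_indicator_le:
  assumes m: "1 \<le> m" and A: "finite A" "card A \<le> m"
  shows "F.N (\<Sum>k\<in>A. basis k) \<le> 4 * s m"
proof (rule F.N_le)
  fix i
  show "seminorm i (\<Sum>k\<in>A. basis k) \<le> 4 * s m"
  proof (cases "A = {}")
    case True
    then have "seminorm i (\<Sum>k\<in>A. basis k) = 0"
      by (simp only: sum.empty F.p_zero)
    then show ?thesis using s_pos[OF m] by linarith
  next
    case False
    then have "1 \<le> card A" using A by (simp add: Suc_le_eq card_gt_0_iff)
    then have "s (card A) \<le> s m" using A(2) by (intro mono_onD[OF s_mono]) auto
    then show ?thesis
      using seminorm_indicator_le[OF A(1) False, of i, where ?'k = 'k]
      by (simp add: F.sum_unit_seq[OF A(1)])
  qed
qed

lemma fundamental_bounds: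
  assumes m: "1 \<le> m"
  shows "s m \<le> F.fundamental basis m" "F.fundamental basis m \<le> 4 * s m"
proof -
  have ne: "{A. finite A \<and> card A \<le> m} \<noteq> {}" by (auto intro!: exI[of _ "{}"])
  show "F.fundamental basis m \<le> 4 * s m"
    unfolding F.fundamental_def by (rule cSUP_least[OF ne]) (auto intro: N_indicator_le[OF m])
  \<comment> \<open>The initial segment, tested against its own Marcinkiewicz seminorm without the
    weighted part, attains exactly \<open>s m\<close>.\<close>
  have "s m = seminorm ({..<m}, 0) (\<Sum>k<m. basis k)"
    using m by (simp add: F.sum_unit_seq seminorm_def)
  also have "\<dots> \<le> F.N (\<Sum>k<m. basis k)"
    by (intro F.p_le_N F.subspace_sum F.subspace_X F.unit_in_X)
  also have "\<dots> \<le> F.fundamental basis m"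
    unfolding F.fundamental_def
  proof (rule cSUP_upper)
    show "bdd_above ((\<lambda>A. F.N (\<Sum>k\<in>A. basis k)) ` {A. finite A \<and> card A \<le> m})"
      by (rule bdd_aboveI2[of _ _ "4 * s m"]) (auto intro: N_indicator_le[OF m])
  qed auto
  finally show "s m \<le> F.fundamental basis m" .
qed

lemma dual_norm_indicator_le:
  assumes m: "1 \<le> m" and A: "finite A" "card A \<le> m"
  shows "F.dual_norm (\<lambda>v. \<Sum>k\<in>A. F.coord basis k v) \<le> real m / s m"
proof (rule F.dual_norm_le)
  show "0 \<le> real m / s m" using s_pos[OF m] by simp
  fix v :: "nat \<Rightarrow> 'k" assume v: "v \<in> F.X"
  show "norm (\<Sum>k\<in>A. F.coord basis k v) \<le> real m / s m * F.N v"
  proof (cases "A = {}")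
    case True
    then show ?thesis using s_pos[OF m] F.N_nonneg[OF v] by simp
  next
    case False
    then have c: "1 \<le> card A" using A by (simp add: Suc_le_eq card_gt_0_iff)
    have "norm (\<Sum>k\<in>A. F.coord basis k v) \<le> (\<Sum>k\<in>A. norm (v k))"
      using v by (simp add: F.coord_unit norm_sum)
    also have "\<dots> \<le> real (card A) / s (card A) * F.N v"
      by (rule sum_norm_le_N[OF v A(1) False])
    also have "\<dots> \<le> real m / s m * F.N v"
      \<comment> \<open>Monotonicity of \<open>m / s m\<close> replaces \<open>card A\<close> by
        \<open>m\<close>.\<close>
      using c A(2) by (intro mult_right_mono F.N_nonneg v mono_onD[OF ratio_mono]) auto
    finally show ?thesis .
  qed
qed

lemma bidemocratic_basis: "F.bidemocratic basis"
  unfolding F.bidemocratic_def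
proof (intro exI[of _ 4] allI impI)
  fix m :: nat assume m: "1 \<le> m"
  have "{A. finite A \<and> card A \<le> m} \<noteq> {}" by (auto intro!: exI[of _ "{}"])
  then have d: "F.dual_fundamental basis m \<le> real m / s m"
    unfolding F.dual_fundamental_def
    by (rule cSUP_least) (auto intro: dual_norm_indicator_le[OF m])
  have "F.fundamental basis m * F.dual_fundamental basis m
      \<le> F.fundamental basis m * (real m / s m)"
    using d fundamental_bounds(1)[OF m] s_pos[OF m] by (intro mult_left_mono) auto
  also have "\<dots> \<le> (4 * s m) * (real m / s m)"
    using fundamental_bounds(2)[OF m] s_pos[OF m] by (intro mult_right_mono) auto
  also have "\<dots> = 4 * real m" using s_pos[OF m] by simp
  finally show "F.fundamental basis m * F.dual_fundamental basis m \<le> 4 * real m" .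
qed

section \<open>Quasi-greediness\<close>

text \<open>The weighted sum over the greedy set \<open>A\<close> is compared with the full one on the first
  \<open>card A\<close> coordinates, where the discarded coefficients are smaller than all the retained ones;
  beyond \<open>card A\<close> the weight is at most \<open>w (card A)\<close>.\<close>

lemma weighted_sum_greedy_le:
  fixes v :: "nat \<Rightarrow> 'k"
  assumes v: "v \<in> F.X" and A: "finite A" "A \<noteq> {}"
    and greedy: "\<And>n k. n \<in> A \<Longrightarrow> k \<notin> A \<Longrightarrow> norm (v k) \<le> norm (v n)"
  shows "norm (\<Sum>n<m. of_real (w n) * (if n \<in> A then v n else 0)) \<le> 7 * F.N v"
proof -
  define M where "M = card A"
  have M: "1 \<le> M" using A by (simp add: M_def Suc_le_eq card_gt_0_iff)
  \<comment> \<open>The least retained modulus is a threshold: every discarded coefficient is at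
    most \<open>l\<close>.\<close>
  define l where "l = Min ((\<lambda>n. norm (v n)) ` A)"
  have l_le: "l \<le> norm (v n)" if "n \<in> A" for n
    unfolding l_def using A that by (intro Min_le) auto
  have "l \<in> (\<lambda>n. norm (v n)) ` A" unfolding l_def using A by (intro Min_in) auto
  then have le_l: "norm (v k) \<le> l" if "k \<notin> A" for k using greedy that by auto
  have l0: "0 \<le> l" unfolding l_def using A by (intro Min.boundedI) auto
  have sumA: "(\<Sum>n\<in>A. norm (v n)) \<le> real M / s M * F.N v"
    unfolding M_def by (rule sum_norm_le_N[OF v A])
  have "real M * l \<le> (\<Sum>n\<in>A. norm (v n))"
    unfolding M_def using sum_bounded_below[of A l "\<lambda>n. norm (v n)"] l_le by simp
  with sumA have "real M * l \<le> real M / s M * F.N v" by linarith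
  \<comment> \<open>\<open>M\<close> coefficients of modulus at least \<open>l\<close> force this
    through the Marcinkiewicz bound.\<close>
  then have ls: "l * s M \<le> F.N v"
    using M s_pos[OF M] by (simp add: field_simps)
  let ?g = "\<lambda>n. of_real (w n) * (if n \<in> A then v n else 0)"
  let ?h = "\<lambda>n. of_real (w n) * (if n \<in> A then 0 else v n)"
  \<comment> \<open>Full sum minus discarded part gives 1 + 3: the discarded coefficients are at
    most \<open>l\<close>, and the first \<open>M\<close> weights sum to at most
    \<open>3 * s M\<close>.\<close>
  have head: "norm (\<Sum>n<r. ?g n) \<le> 4 * F.N v" if r: "r \<le> M" for r
  proof -
    have "norm (\<Sum>n<r. ?h n) \<le> (\<Sum>n<r. w n * l)"
      by (rule sum_norm_le) (auto simp: norm_mult w_nonneg l0 intro!: mult_left_mono le_l)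
    also have "\<dots> \<le> (\<Sum>n<M. w n * l)"
      using r by (intro sum_mono2) (auto simp: w_nonneg l0)
    also have "\<dots> = (\<Sum>n<M. w n) * l" by (rule sum_distrib_right[symmetric])
    also have "\<dots> \<le> 3 * s M * l" by (intro mult_right_mono sum_w_le[OF M] l0)
    also have "\<dots> \<le> 3 * F.N v" using ls by (simp add: mult.commute)
    finally have h: "norm (\<Sum>n<r. ?h n) \<le> 3 * F.N v" .
    have "(\<Sum>n<r. ?g n) = (\<Sum>n<r. of_real (w n) * v n) - (\<Sum>n<r. ?h n)"
      unfolding sum_subtractf[symmetric] by (intro sum.cong) auto
    then have "norm (\<Sum>n<r. ?g n) \<le> norm (\<Sum>n<r. of_real (w n) * v n) + norm (\<Sum>n<r. ?h n)"
      by (simp only: norm_triangle_ineq4)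
    then show ?thesis using h norm_weighted_sum_le_N[OF v, of r] by linarith
  qed
  show ?thesis
  proof (cases "m \<le> M")
    case True
    then show ?thesis using head[OF True] F.N_nonneg[OF v] by linarith
  next
    case False
    \<comment> \<open>The tail costs another 3 via \<open>w_card_le\<close>, for a total of
      7.\<close>
    have "norm (\<Sum>n=M..<m. ?g n) \<le> (\<Sum>n=M..<m. w M * (if n \<in> A then norm (v n) else 0))"
    proof (rule sum_norm_le)
      fix n assume "n \<in> {M..<m}"
      then have "w n \<le> w M" by (intro antimonoD[OF w_antimono]) auto
      then show "norm (?g n) \<le> w M * (if n \<in> A then norm (v n) else 0)"
        by (auto simp: norm_mult w_nonneg intro: mult_right_mono)
    qed
    also have "\<dots> = w M * (\<Sum>n\<in>{M..<m} \<inter> A. norm (v n))"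
      by (simp only: sum_distrib_left[symmetric] sum.inter_restrict[OF finite_atLeastLessThan])
    also have "\<dots> \<le> w M * (\<Sum>n\<in>A. norm (v n))"
      by (intro mult_left_mono w_nonneg sum_mono2 A) auto
    also have "\<dots> \<le> w M * (real M / s M * F.N v)"
      by (intro mult_left_mono w_nonneg sumA)
    also have "\<dots> = w M * (real M / s M) * F.N v" by simp
    also have "\<dots> \<le> 3 * F.N v"
      by (intro mult_right_mono w_card_le[OF M] F.N_nonneg[OF v])
    finally have t: "norm (\<Sum>n=M..<m. ?g n) \<le> 3 * F.N v" .
    have "(\<Sum>n<m. ?g n) = (\<Sum>n<M. ?g n) + (\<Sum>n=M..<m. ?g n)"
      using sum.atLeastLessThan_concat[of 0 M m ?g] False by (simp only: atLeast0LessThan)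
    then have "norm (\<Sum>n<m. ?g n) \<le> norm (\<Sum>n<M. ?g n) + norm (\<Sum>n=M..<m. ?g n)"
      by (simp only: norm_triangle_ineq)
    then show ?thesis using t head[of M] by linarith
  qed
qed

lemma quasi_greedy_basis: "F.quasi_greedy basis"
  unfolding F.quasi_greedy_def
\<comment> \<open>8 is 1 + 7: the Marcinkiewicz part only decreases when coordinates are
  erased.\<close>
proof (intro exI[of _ 8] ballI allI impI)
  fix v :: "nat \<Rightarrow> 'k" and A
  assume v: "v \<in> F.X" and "F.greedy_set basis v A"
  then have A: "finite A" and greedy: "\<And>n k. n \<in> A \<Longrightarrow> k \<notin> A \<Longrightarrow> norm (v k) \<le> norm (v n)"
    unfolding F.greedy_set_def by (auto simp: F.coord_unit)
  have N0: "0 \<le> F.N v" by (rule F.N_nonneg[OF v])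
  show "F.N (F.coord_proj basis A v) \<le> 8 * F.N v"
    unfolding F.coord_proj_unit[OF v A]
  proof (rule F.N_le)
    fix i :: "nat set \<times> nat"
    obtain B m where i: "i = (B, m)" by fastforce
    have "s (card B) / real (card B) * (\<Sum>n\<in>B. norm (if n \<in> A then v n else 0))
        \<le> s (card B) / real (card B) * (\<Sum>n\<in>B. norm (v n))"
      by (intro mult_left_mono sum_mono marcinkiewicz_coeff_nonneg) auto
    also have "\<dots> \<le> F.N v"
      using F.p_le_N[OF v, of "(B, 0)"] by (simp add: seminorm_def)
    finally have "s (card B) / real (card B) * (\<Sum>n\<in>B. norm (if n \<in> A then v n else 0)) \<le> F.N v" .
    moreover have "norm (\<Sum>n<m. of_real (w n) * (if n \<in> A then v n else 0)) \<le> 7 * F.N v"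
    proof (cases "A = {}")
      case False
      show ?thesis by (rule weighted_sum_greedy_le[OF v A False greedy])
    qed (use N0 in simp)
    ultimately show "seminorm i (\<lambda>n. if n \<in> A then v n else 0) \<le> 8 * F.N v"
      by (simp add: i seminorm_def)
  qed
qed

section \<open>Conditionality\<close>

lemma antimono_wa: "antimono (\<lambda>n. w n * a n)"
  by (intro antimonoI mult_mono w_nonneg a_nonneg antimonoD[OF w_antimono] antimonoD[OF a_antimono])

definition alternating :: "nat \<Rightarrow> nat \<Rightarrow> 'k" where
  "alternating r n = (if n < r then of_real ((-1) ^ n * a n) else 0)"

lemma alternating_in_X: "alternating r \<in> F.X"
  by (rule F.finite_support_in_X, rule finite_subset[of _ "{..<r}"])
    (auto simp: alternating_def split: if_splits)

text \<open>The bound must not depend on \<open>r\<close>: signs do not affect the Marcinkiewicz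
  part, at most 3, while in the weighted part they make an alternating sum of the nonincreasing
  \<open>w n * a n\<close>.\<close>

lemma N_alternating_le: "F.N (alternating r) \<le> 3 + w 0 * a 0"
proof (rule F.N_le)
  fix i :: "nat set \<times> nat"
  obtain B m where i: "i = (B, m)" by fastforce
  have "s (card B) / real (card B) * (\<Sum>n\<in>B. norm (alternating r n)) \<le> 3"
  proof (cases "finite B")
    case True
    have "(\<Sum>n\<in>B. norm (alternating r n)) \<le> sum a B"
      by (intro sum_mono) (auto simp: alternating_def a_nonneg norm_mult norm_power)
    then have "s (card B) / real (card B) * (\<Sum>n\<in>B. norm (alternating r n))
        \<le> s (card B) / real (card B) * sum a B"
      by (intro mult_left_mono marcinkiewicz_coeff_nonneg)
    then show ?thesis using sum_a_set_le[OF True] by linarith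
  qed simp
  moreover have "norm (\<Sum>n<m. of_real (w n) * alternating r n) \<le> w 0 * a 0"
  proof -
    have "(\<Sum>n<m. of_real (w n) * alternating r n)
        = (\<Sum>n<min m r. of_real (w n * ((-1) ^ n * a n)))"
      by (rule sum.mono_neutral_cong_right) (auto simp: alternating_def)
    also have "\<dots> = of_real (\<Sum>n<min m r. w n * ((-1) ^ n * a n))" by (simp only: of_real_sum)
    also have "(\<Sum>n<min m r. w n * ((-1) ^ n * a n)) = (\<Sum>n<min m r. (-1) ^ n * (w n * a n))"
      by (intro sum.cong refl mult.left_commute)
    finally have "norm (\<Sum>n<m. of_real (w n) * alternating r n)
        = \<bar>\<Sum>n<min m r. (-1) ^ n * (w n * a n)\<bar>" by (simp only: norm_of_real)
    then show ?thesis
      using alternating_sum_bounds[OF antimono_wa mult_nonneg_nonneg[OF w_nonneg a_nonneg], of "min m r"]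
      by linarith
  qed
  ultimately show "seminorm i (alternating r) \<le> 3 + w 0 * a 0"
    by (simp add: i seminorm_def)
qed

text \<open>On even indices all signs are positive, so the weighted sum has no cancellation and
  retains at least half of the full sum.\<close>

lemma N_even_part_ge:
  "(\<Sum>n<r. w n * a n) \<le> 2 * F.N (F.coord_proj basis {n. n < r \<and> even n} (alternating r))"
proof -
  let ?E = "{n. n < r \<and> even n}"
  have fE: "finite ?E" by simp
  let ?v = "\<lambda>n. if n \<in> ?E then alternating r n else 0"
  have "?v \<in> F.X"
    by (intro F.finite_support_in_X finite_subset[OF _ fE]) auto
  then have "norm (\<Sum>n<r. of_real (w n) * ?v n) \<le> F.N ?v"
    by (rule norm_weighted_sum_le_N)
  moreover have "(\<Sum>n<r. of_real (w n) * ?v n) = (\<Sum>n\<in>?E. of_real (w n * a n))"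
    by (rule sum.mono_neutral_cong_right) (auto simp: alternating_def)
  moreover have "norm (\<Sum>n\<in>?E. of_real (w n * a n) :: 'k) = (\<Sum>n\<in>?E. w n * a n)"
    unfolding of_real_sum[symmetric] norm_of_real
    by (intro abs_of_nonneg sum_nonneg mult_nonneg_nonneg w_nonneg a_nonneg)
  moreover have "(\<Sum>n<r. w n * a n) \<le> 2 * (\<Sum>n\<in>?E. w n * a n)"
    by (intro sum_even_ge_half antimono_wa mult_nonneg_nonneg w_nonneg a_nonneg)
  ultimately show ?thesis
    unfolding F.coord_proj_unit[OF alternating_in_X fE] by simp
qed

lemma conditional_basis: "F.conditional basis"
proof
  assume unc: "F.unconditional basis"
  obtain K where K: "\<And>A v. finite A \<Longrightarrow> v \<in> F.X \<Longrightarrow> F.N (F.coord_proj basis A v) \<le> K * F.N v"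
    using F.unconditional_bound[OF unc] by blast
  \<comment> \<open>The absolute value makes the factor nonnegative, as the monotonicity step
    requires; \<open>K\<close> itself has no known sign.\<close>
  define B where "B = \<bar>K\<bar> * (3 + w 0 * a 0)"
  have "real k \<le> 4 * B" for k
  proof -
    let ?v = "alternating (q k)"
    have "real k / 2 \<le> (\<Sum>n<q k. w n * a n)"
      using sum_inverse_block_end_ge[of k] by (simp only: aw_eq)
    also have "\<dots> \<le> 2 * F.N (F.coord_proj basis {n. n < q k \<and> even n} ?v)"
      by (rule N_even_part_ge)
    also have "\<dots> \<le> 2 * (K * F.N ?v)"
      by (intro mult_left_mono K alternating_in_X) auto
    also have "\<dots> \<le> 2 * B"
      unfolding B_def using F.N_nonneg[OF alternating_in_X] N_alternating_le
      by (intro mult_left_mono mult_mono) auto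
    finally show ?thesis by simp
  qed
  then show False using reals_Archimedean2[of "4 * B"] by (meson not_le)
qed

lemma exists_conditional_basis:
  "\<exists>(X :: (nat \<Rightarrow> 'k) set) N x.
      banach_carrier seq_scale X N \<and>
      normed_carrier.is_basis seq_scale X N x \<and>
      normed_carrier.conditional seq_scale X N x \<and>
      normed_carrier.bidemocratic seq_scale X N x \<and>
      normed_carrier.quasi_greedy seq_scale X N x \<and>
      (\<exists>c C. 0 < c \<and> c \<le> C \<and>
        (\<forall>m\<ge>1. c * s m \<le> normed_carrier.fundamental N x m \<and>
               normed_carrier.fundamental N x m \<le> C * s m))"
proof (intro exI conjI)
  show "banach_carrier seq_scale (F.X :: (nat \<Rightarrow> 'k) set) F.N"
    by (rule F.banach_carrier_axioms)
  show "F.is_basis basis" by (rule F.is_basis_unit)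
  show "F.conditional basis" by (rule conditional_basis)
  show "F.bidemocratic basis" by (rule bidemocratic_basis)
  show "F.quasi_greedy basis" by (rule quasi_greedy_basis)
  \<comment> \<open>Unification with this goal fixes the witnesses \<open>c = 1\<close> and
    \<open>C = 4\<close>.\<close>
  show "\<forall>m\<ge>1. 1 * s m \<le> F.fundamental basis m \<and> F.fundamental basis m \<le> 4 * s m"
    using fundamental_bounds by simp
qed auto

end
end

theorem theorem4p9:
  fixes s :: "nat \<Rightarrow> real"
  assumes s_pos: "\<And>m. m \<ge> 1 \<Longrightarrow> s m > 0"
    and s_mono: "mono_on {1..} s"
    and s_unbdd: "\<not> bdd_above (s ` {1..})"
    and ratio_mono: "mono_on {1..} (\<lambda>m. real m / s m)"
    and ratio_unbdd: "\<not> bdd_above ((\<lambda>m. real m / s m) ` {1..})"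
  shows
    "(\<exists>(X :: (nat \<Rightarrow> real) set) N x.
        banach_carrier seq_scale X N \<and>
        normed_carrier.is_basis seq_scale X N x \<and>
        normed_carrier.conditional seq_scale X N x \<and>
        normed_carrier.bidemocratic seq_scale X N x \<and>
        normed_carrier.quasi_greedy seq_scale X N x \<and>
        (\<exists>c C. 0 < c \<and> c \<le> C \<and>
          (\<forall>m\<ge>1. c * s m \<le> normed_carrier.fundamental N x m \<and>
                 normed_carrier.fundamental N x m \<le> C * s m))) \<and>
     (\<exists>(X :: (nat \<Rightarrow> complex) set) N x.
        banach_carrier seq_scale X N \<and>
        normed_carrier.is_basis seq_scale X N x \<and>
        normed_carrier.conditional seq_scale X N x \<and>
        normed_carrier.bidemocratic seq_scale X N x \<and>
        normed_carrier.quasi_greedy seq_scale X N x \<and>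
        (\<exists>c C. 0 < c \<and> c \<le> C \<and>
          (\<forall>m\<ge>1. c * s m \<le> normed_carrier.fundamental N x m \<and>
                 normed_carrier.fundamental N x m \<le> C * s m)))"
proof -
  \<comment> \<open>The same points must serve \<open>s\<close> and \<open>m / s m\<close>, since
    \<open>w\<close> and \<open>a\<close> are steps on common blocks.\<close>
  obtain q where "doubling_blocks q" "\<And>k. 2 * s (q k) \<le> s (q (Suc k))"
    "\<And>k. 2 * (real (q k) / s (q k)) \<le> real (q (Suc k)) / s (q (Suc k))"
    using exists_doubling_sequence[OF s_mono s_unbdd ratio_mono ratio_unbdd] by blast
  then interpret fundamental_data q s
    by (intro fundamental_data.intro fundamental_data_axioms.intro s_pos s_mono ratio_mono)
  show ?thesis by (intro conjI exists_conditional_basis)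
qed

end
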